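(* Let $n\ge 2$, $Q^0,Q^1\in\mathbb{S}^{n-1}$, $q_0,q_1\in\mathbb{R}^{n-1}$, $b_1\in\mathbb{R}$, $b_0=0$, and put $$\bar Q^p:=\begin{bmatrix}-b_p & q_p^{\mathrm T}\\ q_p & Q^p\end{bmatrix}\in\mathbb{S}^n,\qquad p=0,1.$$ Consider the (homogenized) generalized trust-region subproblem $$\min_{x\in\mathbb{R}^n}\ x^{\mathrm T}\bar Q^0x\quad\text{subject to}\quad x^{\mathrm T}\bar Q^1x\le 0,\quad x^{\mathrm T}E_{11}x=1,$$ and its SDP relaxation $$\min_{X\in\mathbb{S}^n}\ \bar Q^0\bullet X\quad\text{subject to}\quad \bar Q^1\bullet X\le 0,\quad E_{11}\bullet X=1,\quad X\succeq O.$$ Assume that: (a) the homogenized problem has a feasible point; (b) there exist $\bar y_1,\bar y_2,\bar y_3\ge 0$ with $\bar y_1\bar Q^1+\bar y_2E_{11}-\bar y_3E_{11}\succ O$; (c) the SDP relaxation has an interior feasible point. Then the SDP relaxation is exact.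
   Context: $\mathbb{S}^n$ is the space of real symmetric $n\times n$ matrices; $M\succeq O$ (resp. $M\succ O$) means positive semidefinite (resp. positive definite); $M\bullet N=\operatorname{tr}(M^{\mathrm T}N)$; $E_{11}$ is the $n\times n$ matrix whose $(1,1)$ entry is $1$ and whose other entries are $0$. The problem is the homogenization of the generalized trust-region subproblem $\min_x\ x^{\mathrm T}Q^0x+2q_0^{\mathrm T}x$ subject to $x^{\mathrm T}Q^1x+2q_1^{\mathrm T}x\le b_1$; the equality $x^{\mathrm T}E_{11}x=1$ is regarded as the two inequalities $x^{\mathrm T}E_{11}x\le 1$ and $-x^{\mathrm T}E_{11}x\le -1$. An interior feasible point of the SDP relaxation is a matrix $X\succ O$ satisfying its linear constraints. The SDP relaxation is called exact if it has an optimal solution of the form $X^*=x^*(x^* )^{\mathrm T}$ with $x^*\in\mathbb{R}^n$. *)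

theory Defs
  imports "HOL-Analysis.Analysis"
begin

text \<open>
  The dimension \<open>n - 1 \<ge> 1\<close> is the cardinality of a finite index type \<open>'m\<close>, and
  \<open>n\<close> is the cardinality of \<open>'m option\<close>: the first coordinate (the homogenizing
  one) is \<open>None\<close>, the remaining \<open>n - 1\<close> coordinates are the \<open>Some i\<close>. As types
  are nonempty, \<open>n \<ge> 2\<close> holds automatically.
\<close>

definition symmetric_matrix :: "real^'n^'n \<Rightarrow> bool" where
  "symmetric_matrix M \<longleftrightarrow> transpose M = M"

definition pos_semidef :: "real^'n^'n \<Rightarrow> bool" where
  "pos_semidef M \<longleftrightarrow> symmetric_matrix M \<and> (\<forall>x. 0 \<le> x \<bullet> (M *v x))"

definition pos_def :: "real^'n^'n \<Rightarrow> bool" where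
  "pos_def M \<longleftrightarrow> symmetric_matrix M \<and> (\<forall>x. x \<noteq> 0 \<longrightarrow> 0 < x \<bullet> (M *v x))"

definition mat_inner :: "real^'n^'n \<Rightarrow> real^'n^'n \<Rightarrow> real" where
  "mat_inner M N = trace (transpose M ** N)"

definition outer :: "real^'n \<Rightarrow> real^'n^'n" where
  "outer x = (\<chi> i j. x $ i * x $ j)"

definition E11 :: "real^('m::finite) option^'m option" where
  "E11 = (\<chi> i j. if i = None \<and> j = None then 1 else 0)"

text \<open>The block matrix with rows \<open>(-b, q\<^sup>T)\<close> and \<open>(q, Q)\<close>.\<close>

definition homogenized :: "real \<Rightarrow> real^'m \<Rightarrow> real^'m^'m \<Rightarrow> real^'m option^'m option" where
  "homogenized b q Q = (\<chi> i j.
     (case i of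
        None \<Rightarrow> (case j of None \<Rightarrow> - b | Some l \<Rightarrow> q $ l)
      | Some k \<Rightarrow> (case j of None \<Rightarrow> q $ k | Some l \<Rightarrow> Q $ k $ l)))"

definition hgtrs_feasible :: "real^('m::finite) option^'m option \<Rightarrow> real^'m option \<Rightarrow> bool" where
  "hgtrs_feasible A1 x \<longleftrightarrow> x \<bullet> (A1 *v x) \<le> 0 \<and> x \<bullet> (E11 *v x) = 1"

definition sdp_linear_constraints ::
    "real^('m::finite) option^'m option \<Rightarrow> real^'m option^'m option \<Rightarrow> bool" where
  "sdp_linear_constraints A1 X \<longleftrightarrow> mat_inner A1 X \<le> 0 \<and> mat_inner E11 X = 1"

definition sdp_feasible :: "real^('m::finite) option^'m option \<Rightarrow> real^'m option^'m option \<Rightarrow> bool" where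
  "sdp_feasible A1 X \<longleftrightarrow> sdp_linear_constraints A1 X \<and> pos_semidef X"

definition sdp_interior_feasible ::
    "real^('m::finite) option^'m option \<Rightarrow> real^'m option^'m option \<Rightarrow> bool" where
  "sdp_interior_feasible A1 X \<longleftrightarrow> sdp_linear_constraints A1 X \<and> pos_def X"

definition sdp_optimal ::
    "real^('m::finite) option^'m option \<Rightarrow> real^'m option^'m option \<Rightarrow> real^'m option^'m option \<Rightarrow> bool" where
  "sdp_optimal A0 A1 X \<longleftrightarrow>
     sdp_feasible A1 X \<and> (\<forall>Y. sdp_feasible A1 Y \<longrightarrow> mat_inner A0 X \<le> mat_inner A0 Y)"

definition sdp_exact :: "real^('m::finite) option^'m option \<Rightarrow> real^'m option^'m option \<Rightarrow> bool" where
  "sdp_exact A0 A1 \<longleftrightarrow> (\<exists>x. sdp_optimal A0 A1 (outer x))"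

end

theory Submission
  imports Defs
begin

text \<open>
  Positive definiteness of \<open>y\<^sub>1 A\<^sub>1 + t E\<^sub>1\<^sub>1\<close> makes the feasible set of the
  homogenized problem compact, so it has a minimizer \<open>x\<^sup>*\<close> with value \<open>v\<close>. By the rank-one
  decomposition of Sturm and Zhang, every SDP-feasible \<open>X\<close> is a sum of matrices
  \<open>x\<^sub>i x\<^sub>i\<^sup>T\<close> with \<open>x\<^sub>i\<^sup>T A\<^sub>1 x\<^sub>i \<le> 0\<close> for each \<open>i\<close>. If the first entry \<open>a\<^sub>i\<close> of
  \<open>x\<^sub>i\<close> is nonzero, then \<open>x\<^sub>i / a\<^sub>i\<close> is feasible and \<open>x\<^sub>i\<^sup>T A\<^sub>0 x\<^sub>i \<ge> v a\<^sub>i\<^sup>2\<close>; if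
  \<open>a\<^sub>i = 0\<close>, positive definiteness forces \<open>x\<^sub>i = 0\<close>. Since the \<open>a\<^sub>i\<^sup>2\<close> sum to \<open>1\<close>,
  summation gives \<open>A\<^sub>0 \<bullet> X \<ge> v\<close>.
\<close>

section \<open>Trace inner product, quadratic forms and outer products\<close>

lemma mat_inner_eq_sum: "mat_inner M N = (\<Sum>i\<in>UNIV. \<Sum>j\<in>UNIV. M $ i $ j * N $ i $ j)"
  unfolding mat_inner_def trace_def matrix_matrix_mult_def transpose_def
  by (simp add: sum.swap[of "\<lambda>i j. M $ j $ i * N $ j $ i"])

lemma mat_inner_add_right: "mat_inner M (N + K) = mat_inner M N + mat_inner M K"
  by (simp add: mat_inner_eq_sum distrib_left sum.distrib)

lemma mat_inner_sum_right: "mat_inner M (sum f I) = (\<Sum>i\<in>I. mat_inner M (f i))"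
proof (induction I rule: infinite_finite_induct)
  case (insert i I)
  then show ?case by (simp add: mat_inner_add_right)
qed (simp_all add: mat_inner_eq_sum)

lemma quadratic_form_eq_sum:
  fixes M :: "real^'n^'n"
  shows "x \<bullet> (M *v y) = (\<Sum>i\<in>UNIV. \<Sum>j\<in>UNIV. x $ i * M $ i $ j * y $ j)"
  by (simp add: inner_vec_def matrix_vector_mult_def sum_distrib_left mult.assoc)

lemma mat_inner_outer: "mat_inner M (outer x) = x \<bullet> (M *v x)"
  by (simp add: mat_inner_eq_sum quadratic_form_eq_sum outer_def mult_ac)

lemma quadratic_form_scaleR:
  fixes M :: "real^'n^'n"
  shows "(c *\<^sub>R x) \<bullet> (M *v (c *\<^sub>R x)) = c\<^sup>2 * (x \<bullet> (M *v x))"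
  by (simp add: matrix_vector_mult_scaleR power2_eq_square)

lemma continuous_on_quadratic_form:
  fixes M :: "real^'n^'n"
  shows "continuous_on S f \<Longrightarrow> continuous_on S (\<lambda>x. f x \<bullet> (M *v f x))"
  by (intro continuous_intros) 
     (auto intro: continuous_on_compose2[OF linear_continuous_on[OF matrix_vector_mul_bounded_linear[of M], of UNIV]])

lemma outer_mult_vec: "outer w *v x = (w \<bullet> x) *\<^sub>R w"
  by (simp add: vec_eq_iff outer_def matrix_vector_mult_def inner_vec_def sum_distrib_left mult_ac)

section \<open>Positive semidefinite matrices as sums of outer products\<close>

lemma pos_semidef_outer: "pos_semidef (outer x)"
  unfolding pos_semidef_def symmetric_matrix_def
  by (simp add: outer_mult_vec inner_commute) (simp add: outer_def transpose_def vec_eq_iff mult.commute)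

lemma symmetric_matrix_inner_commute:
  fixes M :: "real^'n^'n"
  assumes "symmetric_matrix M"
  shows "x \<bullet> (M *v y) = y \<bullet> (M *v x)"
  by (metis assms dot_lmul_matrix inner_commute symmetric_matrix_def vector_transpose_matrix)

text \<open>Nonnegativity of the form at \<open>s x - t y\<close> gives a quadratic inequality in
  \<open>s\<close> and \<open>t\<close>; suitable values of both yield the bound, even when the form
  is degenerate.\<close>

lemma pos_semidef_Cauchy_Schwarz:
  fixes M :: "real^'n^'n"
  assumes "pos_semidef M"
  shows "(x \<bullet> (M *v y))\<^sup>2 \<le> (x \<bullet> (M *v x)) * (y \<bullet> (M *v y))"
proof -
  define a b c where "a = x \<bullet> (M *v x)" and "b = x \<bullet> (M *v y)" and "c = y \<bullet> (M *v y)"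
  have sym: "y \<bullet> (M *v x) = b"
    using assms symmetric_matrix_inner_commute by (auto simp: pos_semidef_def b_def)
  have form: "0 \<le> s\<^sup>2 * a - 2 * s * t * b + t\<^sup>2 * c" for s t
  proof -
    have "0 \<le> (s *\<^sub>R x - t *\<^sub>R y) \<bullet> (M *v (s *\<^sub>R x - t *\<^sub>R y))"
      using assms by (simp add: pos_semidef_def)
    also have "\<dots> = s\<^sup>2 * a - 2 * s * t * b + t\<^sup>2 * c"
      using sym
      by (simp add: a_def b_def c_def matrix_vector_mult_diff_distrib matrix_vector_mult_scaleR
          inner_diff_left inner_diff_right power2_eq_square algebra_simps)
    finally show ?thesis .
  qed
  have "0 \<le> c" using form[of 0 1] by simp
  then consider "c > 0" | "c = 0" by linarith
  then have "b\<^sup>2 \<le> a * c"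
  proof cases
    case 1
    \<comment> \<open>For \<open>s = c\<close> and \<open>t = b\<close> the quadratic factors as
      \<open>c * (a * c - b^2)\<close>.\<close>
    have "0 \<le> c * (a * c - b\<^sup>2)"
      using form[of c b] by (simp add: power2_eq_square algebra_simps)
    then show ?thesis using 1 by (simp add: zero_le_mult_iff)
  next
    case 2
    have "b = 0"
    proof (rule ccontr)
      assume "b \<noteq> 0"
      \<comment> \<open>With \<open>c = 0\<close> the quadratic is affine in \<open>t\<close>; this
        \<open>t\<close> makes its value \<open>a - (a + 1) = -1\<close>.\<close>
      then show False using form[of 1 "(a + 1) / (2 * b)"] 2 by simp
    qed
    then show ?thesis using 2 by simp
  qed
  then show ?thesis by (simp add: a_def b_def c_def)
qed

lemma inner_matrix_axis_axis:
  fixes M :: "real^'n^'n"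
  shows "axis i 1 \<bullet> (M *v axis j 1) = M $ i $ j"
  by (simp add: inner_axis' matrix_vector_mult_basis column_def)

text \<open>Used to see that a zero diagonal entry forces its whole row and column to
  vanish.\<close>

lemma pos_semidef_entry_square_le:
  fixes M :: "real^'n^'n"
  assumes "pos_semidef M"
  shows "(M $ i $ j)\<^sup>2 \<le> M $ i $ i * M $ j $ j"
  using pos_semidef_Cauchy_Schwarz[OF assms, of "axis i 1" "axis j 1"]
  by (simp only: inner_matrix_axis_axis)

lemma pos_semidef_diagonal_nonneg:
  fixes M :: "real^'n^'n"
  assumes "pos_semidef M"
  shows "0 \<le> M $ i $ i"
  using assms unfolding pos_semidef_def by (metis inner_matrix_axis_axis)

text \<open>One step of the Cholesky factorization: it clears the pivot row and column.\<close>

lemma pos_semidef_deflation: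
  fixes M :: "real^'n^'n"
  assumes "pos_semidef M" and "M $ k $ k > 0"
  defines "w \<equiv> (1 / sqrt (M $ k $ k)) *\<^sub>R column k M"
  shows "pos_semidef (M - outer w)"
proof -
  have "0 \<le> x \<bullet> ((M - outer w) *v x)" for x
  proof -
    have "(w \<bullet> x)\<^sup>2 = (x \<bullet> (M *v axis k 1))\<^sup>2 / M $ k $ k"
      using assms(2)
      by (simp add: w_def matrix_vector_mult_basis inner_commute power_divide)
    \<comment> \<open>Cauchy-Schwarz against the \<open>k\<close>-th basis vector: the subtracted
      square never exceeds the form of \<open>M\<close>.\<close>
    also have "\<dots> \<le> x \<bullet> (M *v x)"
      using pos_semidef_Cauchy_Schwarz[OF assms(1), of x "axis k 1"] assms(2)
      by (simp add: inner_matrix_axis_axis divide_le_eq)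
    finally show ?thesis
      by (simp add: matrix_vector_mult_diff_rdistrib outer_mult_vec inner_diff_right
          inner_commute power2_eq_square)
  qed
  moreover have "symmetric_matrix (M - outer w)"
    using assms(1) pos_semidef_outer[of w]
    by (simp add: pos_semidef_def symmetric_matrix_def transpose_def vec_eq_iff)
  ultimately show ?thesis by (simp add: pos_semidef_def)
qed

text \<open>\<open>S\<close> holds the indices whose pivots have not yet been cleared. Each
  induction step deflates one pivot, and an empty \<open>S\<close> leaves a zero diagonal, hence the
  zero matrix.\<close>

lemma pos_semidef_sum_outer_on:
  fixes M :: "real^'n^'n"
  assumes "finite S" and "pos_semidef M" and "\<And>i. i \<notin> S \<Longrightarrow> M $ i $ i = 0"
  shows "\<exists>x. M = (\<Sum>i\<in>S. outer (x i))"
  using assms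
proof (induction S arbitrary: M rule: finite_induct)
  case empty
  have "M $ i $ j = 0" for i j
    using pos_semidef_entry_square_le[OF empty(1), of i j] empty(2) by simp
  then show ?case by (simp add: vec_eq_iff)
next
  case (insert k S)
  define w where "w = (1 / sqrt (M $ k $ k)) *\<^sub>R column k M"
  have "pos_semidef (M - outer w)"
  proof (cases "M $ k $ k = 0")
    case True
    \<comment> \<open>Division by zero yields \<open>0\<close>, so a zero pivot gives
      \<open>w = 0\<close> and nothing is subtracted.\<close>
    then have "outer w = 0" by (simp add: w_def outer_def vec_eq_iff)
    then show ?thesis using insert.prems by simp
  next
    case False
    then have "M $ k $ k > 0"
      using pos_semidef_diagonal_nonneg[OF insert.prems(1), of k] by simp
    then show ?thesis
      unfolding w_def by (rule pos_semidef_deflation[OF insert.prems(1)])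
  qed
  moreover have "(M - outer w) $ i $ i = 0" if "i \<notin> S" for i
  proof (cases "i = k")
    case True
    then show ?thesis using pos_semidef_diagonal_nonneg[OF insert.prems(1), of k]
      by (simp add: outer_def w_def column_def)
  next
    case False
    then have "M $ i $ i = 0" using that insert.prems(2) by auto
    \<comment> \<open>Hence \<open>w\<close> vanishes at \<open>i\<close>, and deflation does not
      disturb diagonal zeros obtained earlier.\<close>
    moreover from this have "M $ i $ k = 0"
      using pos_semidef_entry_square_le[OF insert.prems(1), of i k] by simp
    ultimately show ?thesis by (simp add: outer_def w_def column_def)
  qed
  ultimately obtain x where x: "M - outer w = (\<Sum>i\<in>S. outer (x i))"
    using insert.IH by blast
  have "(\<Sum>i\<in>S. outer ((x(k := w)) i)) = (\<Sum>i\<in>S. outer (x i))"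
    using insert.hyps by (intro sum.cong) auto
  then have "M = (\<Sum>i\<in>insert k S. outer ((x(k := w)) i))"
    using insert.hyps x by (simp add: algebra_simps)
  then show ?case by blast
qed

section \<open>Rank-one decomposition of Sturm and Zhang\<close>

lemma outer_rotation:
  assumes "c\<^sup>2 + s\<^sup>2 = (1::real)"
  shows "outer (c *\<^sub>R x + s *\<^sub>R y) + outer (c *\<^sub>R y - s *\<^sub>R x) = outer x + outer y"
proof -
  have "(c * a + s * b) * (c * a' + s * b') + (c * b - s * a) * (c * b' - s * a')
      = a * a' + b * b'" for a b a' b'
  proof -
    have "(c * a + s * b) * (c * a' + s * b') + (c * b - s * a) * (c * b' - s * a')
        = (c\<^sup>2 + s\<^sup>2) * (a * a' + b * b')"
      by (simp add: power2_eq_square algebra_simps)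
    then show ?thesis by (simp add: assms)
  qed
  then show ?thesis by (simp add: outer_def vec_eq_iff)
qed

text \<open>Rotating the pair \<open>x\<close>, \<open>y\<close> preserves the sum of its outer
  products. Over a quarter turn the first vector moves from \<open>x\<close> to \<open>y\<close>, so
  the form at it passes through zero by the intermediate value theorem.\<close>

lemma outer_pair_isotropic:
  fixes A :: "real^'n^'n"
  assumes "0 \<le> x \<bullet> (A *v x)" and "y \<bullet> (A *v y) \<le> 0"
  obtains u v where "u \<bullet> (A *v u) = 0" and "outer u + outer v = outer x + outer y"
proof -
  define u where "u \<theta> = cos \<theta> *\<^sub>R x + sin \<theta> *\<^sub>R y" for \<theta>
  have "\<exists>\<theta>\<ge>0. \<theta> \<le> pi / 2 \<and> u \<theta> \<bullet> (A *v u \<theta>) = 0"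
  proof (rule IVT2')
    show "continuous_on {0..pi / 2} (\<lambda>\<theta>. u \<theta> \<bullet> (A *v u \<theta>))"
      unfolding u_def by (intro continuous_on_quadratic_form continuous_intros)
  qed (use assms in \<open>simp_all add: u_def\<close>)
  then obtain \<theta> where "u \<theta> \<bullet> (A *v u \<theta>) = 0" by blast
  then show thesis
    using that[of "u \<theta>"] outer_rotation[of "cos \<theta>" "sin \<theta>" x y] by (simp add: u_def)
qed

text \<open>Induction on the number of vectors. One with positive form is paired with one with
  negative form and the pair is rotated until one member is isotropic; that member is set aside and
  the rest is a smaller instance.\<close>

lemma sum_outer_redistribute:
  fixes A :: "real^'n^'n"
  assumes "finite I" and "(\<Sum>i\<in>I. x i \<bullet> (A *v x i)) \<le> 0"
  shows "\<exists>z. (\<Sum>i\<in>I. outer (z i)) = (\<Sum>i\<in>I. outer (x i)) \<and> (\<forall>i\<in>I. z i \<bullet> (A *v z i) \<le> 0)"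
  using assms
proof (induction "card I" arbitrary: I x rule: less_induct)
  case less
  show ?case
  proof (cases "\<forall>i\<in>I. x i \<bullet> (A *v x i) \<le> 0")
    case True
    then show ?thesis by blast
  next
    case False
    then obtain i where i: "i \<in> I" "x i \<bullet> (A *v x i) > 0" by force
    obtain j where j: "j \<in> I" "x j \<bullet> (A *v x j) < 0"
    proof (rule ccontr)
      assume "\<not> thesis"
      then have "\<forall>j\<in>I. 0 \<le> x j \<bullet> (A *v x j)" using that by force
      then have "0 < (\<Sum>i\<in>I. x i \<bullet> (A *v x i))"
        using i less.prems(1) by (intro sum_pos2[of I i]) auto
      then show False using less.prems(2) by simp
    qed
    obtain u v where u: "u \<bullet> (A *v u) = 0" and uv: "outer u + outer v = outer (x i) + outer (x j)"
      using outer_pair_isotropic[of "x i" A "x j"] i(2) j(2) by auto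
    have "i \<noteq> j" using i j by auto
    define J where "J = I - {i, j}"
    have I: "I = insert i (insert j J)" "i \<notin> insert j J" "j \<notin> J" and J: "finite J"
      using i j \<open>i \<noteq> j\<close> less.prems(1) by (auto simp: J_def)
    \<comment> \<open>The partner \<open>v\<close> takes over index \<open>j\<close>, while index
      \<open>i\<close> is reserved for the isotropic \<open>u\<close>.\<close>
    define x' where "x' = x(j := v)"
    have sum_x': "(\<Sum>k\<in>insert j J. outer (x' k)) = outer v + (\<Sum>k\<in>J. outer (x k))"
    proof -
      have "(\<Sum>k\<in>J. outer (x' k)) = (\<Sum>k\<in>J. outer (x k))"
        using I by (intro sum.cong) (auto simp: x'_def)
      then show ?thesis using I J by (simp add: x'_def)
    qed
    have total: "outer u + (\<Sum>k\<in>insert j J. outer (x' k)) = (\<Sum>k\<in>I. outer (x k))"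
      unfolding sum_x' using I J uv by (simp add: add.assoc[symmetric])
    \<comment> \<open>The total of the form depends only on the sum of the outer products, and
      \<open>u\<close> contributes zero, so the smaller family keeps the old total.\<close>
    have "(\<Sum>k\<in>insert j J. x' k \<bullet> (A *v x' k)) = mat_inner A (\<Sum>k\<in>insert j J. outer (x' k))"
      by (simp only: mat_inner_sum_right mat_inner_outer)
    also have "\<dots> = mat_inner A (outer u + (\<Sum>k\<in>insert j J. outer (x' k)))"
      by (simp only: mat_inner_add_right mat_inner_outer u add_0)
    also have "\<dots> = (\<Sum>k\<in>I. x k \<bullet> (A *v x k))"
      by (simp only: total mat_inner_sum_right mat_inner_outer)
    finally have "(\<Sum>k\<in>insert j J. x' k \<bullet> (A *v x' k)) \<le> 0" using less.prems(2) by simp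
    moreover have "card (insert j J) < card I" using I J by (metis card_insert_disjoint finite_insert lessI)
    ultimately obtain z where z: "(\<Sum>k\<in>insert j J. outer (z k)) = (\<Sum>k\<in>insert j J. outer (x' k))"
      "\<forall>k\<in>insert j J. z k \<bullet> (A *v z k) \<le> 0"
      using less.hyps[of "insert j J" x'] J by blast
    have "(\<Sum>k\<in>insert j J. outer ((z(i := u)) k)) = (\<Sum>k\<in>insert j J. outer (z k))"
      using I by (intro sum.cong) auto
    moreover have "(\<Sum>k\<in>I. outer ((z(i := u)) k))
        = outer u + (\<Sum>k\<in>insert j J. outer ((z(i := u)) k))"
      unfolding I(1) using I(2) J by (subst sum.insert) auto
    ultimately have "(\<Sum>k\<in>I. outer ((z(i := u)) k)) = (\<Sum>k\<in>I. outer (x k))"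
      using total z(1) by simp
    moreover have "\<forall>k\<in>I. (z(i := u)) k \<bullet> (A *v (z(i := u)) k) \<le> 0"
      using z(2) u I by auto
    ultimately show ?thesis by blast
  qed
qed

lemma Sturm_Zhang_decomposition:
  fixes A X :: "real^'n^'n"
  assumes "pos_semidef X" and "mat_inner A X \<le> 0"
  obtains x :: "'n \<Rightarrow> real^'n"
    where "X = (\<Sum>i\<in>UNIV. outer (x i))" and "\<And>i. x i \<bullet> (A *v x i) \<le> 0"
proof -
  have "\<exists>y :: 'n \<Rightarrow> real^'n. X = (\<Sum>i\<in>UNIV. outer (y i))"
    by (rule pos_semidef_sum_outer_on[OF finite assms(1)]) simp
  then obtain y :: "'n \<Rightarrow> real^'n" where y: "X = (\<Sum>i\<in>UNIV. outer (y i))" by (elim exE)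
  have "(\<Sum>i\<in>UNIV. y i \<bullet> (A *v y i)) \<le> 0"
    using assms(2) by (simp add: y mat_inner_sum_right mat_inner_outer)
  from sum_outer_redistribute[OF finite this] obtain z :: "'n \<Rightarrow> real^'n"
    where "(\<Sum>i\<in>UNIV. outer (z i)) = (\<Sum>i\<in>UNIV. outer (y i))" "\<forall>i\<in>UNIV. z i \<bullet> (A *v z i) \<le> 0"
    by (elim exE conjE)
  then show thesis using that[of z] y by simp
qed

section \<open>Coercivity and exactness of the relaxation\<close>

lemma pos_def_coercive:
  fixes P :: "real^'n^'n"
  assumes "pos_def P"
  obtains c where "c > 0" and "\<And>x. c * (norm x)\<^sup>2 \<le> x \<bullet> (P *v x)"
proof -
  \<comment> \<open>The constant will be the minimum of the form over the compact unit sphere;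
    homogeneity carries the bound to all vectors.\<close>
  have "sphere (0 :: real^'n) 1 \<noteq> {}" by simp
  then obtain u :: "real^'n" where u: "u \<in> sphere 0 1"
    "\<And>x. x \<in> sphere 0 1 \<Longrightarrow> u \<bullet> (P *v u) \<le> x \<bullet> (P *v x)"
    using continuous_attains_inf[OF compact_sphere,
        OF _ continuous_on_quadratic_form[OF continuous_on_id, of _ P]] by blast
  show thesis
  proof
    have "u \<noteq> 0" using u(1) by auto
    then show "u \<bullet> (P *v u) > 0" using assms by (simp add: pos_def_def)
    show "(u \<bullet> (P *v u)) * (norm x)\<^sup>2 \<le> x \<bullet> (P *v x)" for x
    proof (cases "x = 0")
      case False
      then have "u \<bullet> (P *v u) \<le> (1 / norm x)\<^sup>2 * (x \<bullet> (P *v x))"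
        using u(2)[of "(1 / norm x) *\<^sub>R x"] quadratic_form_scaleR[of "1 / norm x" x P] by simp
      then show ?thesis using False by (simp add: field_simps)
    qed simp
  qed
qed

lemma E11_form:
  fixes x :: "real^('m::finite) option"
  shows "x \<bullet> (E11 *v x) = (x $ None)\<^sup>2"
proof -
  have E11: "E11 = outer (axis None 1 :: real^'m option)"
    by (simp add: E11_def outer_def axis_def vec_eq_iff)
  show ?thesis
    by (simp only: E11 outer_mult_vec inner_scaleR_right inner_axis inner_axis' inner_real_def
        power2_eq_square mult_1_left mult_1_right)
qed

lemma sdp_exact_of_coercive:
  fixes A0 A1 :: "real^('m::finite) option^'m option"
  assumes feasible: "hgtrs_feasible A1 x0"
    and "y \<ge> 0" and pd: "pos_def (y *\<^sub>R A1 + t *\<^sub>R E11)"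
  shows "sdp_exact A0 A1"
proof -
  let ?F = "Collect (hgtrs_feasible A1)"
  have P: "x \<bullet> ((y *\<^sub>R A1 + t *\<^sub>R E11) *v x) = y * (x \<bullet> (A1 *v x)) + t * (x $ None)\<^sup>2" for x
    by (simp add: matrix_vector_mult_add_rdistrib inner_add_right E11_form flip: scaleR_matrix_vector_assoc)
  obtain c where c: "c > 0" "\<And>x. c * (norm x)\<^sup>2 \<le> y * (x \<bullet> (A1 *v x)) + t * (x $ None)\<^sup>2"
    using pos_def_coercive[OF pd] unfolding P by blast
  have "compact ?F"
    unfolding compact_eq_bounded_closed
  proof
    \<comment> \<open>On the feasible set the \<open>A1\<close> term is nonpositive and the
      \<open>E11\<close> term equals \<open>t\<close>, so coercivity gives
      \<open>c * (norm x)^2 \<le> t\<close>.\<close>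
    have "norm x \<le> sqrt (t / c)" if "x \<in> ?F" for x
    proof -
      have "y * (x \<bullet> (A1 *v x)) \<le> 0" "(x $ None)\<^sup>2 = 1"
        using that \<open>y \<ge> 0\<close> by (auto simp: hgtrs_feasible_def E11_form mult_nonneg_nonpos)
      then have "c * (norm x)\<^sup>2 \<le> t" using c(2)[of x] by simp
      then show ?thesis using c(1) by (intro real_le_rsqrt) (simp add: field_simps)
    qed
    then show "bounded ?F" by (rule boundedI)
    show "closed ?F"
      unfolding hgtrs_feasible_def
      by (intro closed_Collect_conj closed_Collect_le closed_Collect_eq
          continuous_on_quadratic_form continuous_intros)
  qed
  moreover have "?F \<noteq> {}" using feasible by blast
  ultimately obtain x where x: "hgtrs_feasible A1 x"
    and x_min: "\<And>z. hgtrs_feasible A1 z \<Longrightarrow> x \<bullet> (A0 *v x) \<le> z \<bullet> (A0 *v z)"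
    using continuous_attains_inf[of ?F "\<lambda>x. x \<bullet> (A0 *v x)"]
      continuous_on_quadratic_form[OF continuous_on_id] by auto
  define v where "v = x \<bullet> (A0 *v x)"
  \<comment> \<open>Homogeneous form of the minimality of \<open>x\<close>, valid on the whole cone
    where the \<open>A1\<close> form is nonpositive; it can be summed over a rank-one
    decomposition.\<close>
  have cone_bound: "v * (z $ None)\<^sup>2 \<le> z \<bullet> (A0 *v z)" if z: "z \<bullet> (A1 *v z) \<le> 0" for z
  proof (cases "z $ None = 0")
    case True
    have "c * (norm z)\<^sup>2 \<le> 0"
      using c(2)[of z] z True \<open>y \<ge> 0\<close> mult_nonneg_nonpos[of y] by fastforce
    then have "z = 0" using c(1) by (simp add: mult_le_0_iff)
    then show ?thesis by simp
  next
    case False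
    define r where "r = 1 / z $ None"
    have "hgtrs_feasible A1 (r *\<^sub>R z)"
      unfolding hgtrs_feasible_def quadratic_form_scaleR
      using z False by (simp add: E11_form r_def power_divide mult_nonneg_nonpos divide_nonpos_pos)
    then have "v \<le> r\<^sup>2 * (z \<bullet> (A0 *v z))"
      unfolding v_def quadratic_form_scaleR[of r z A0, symmetric] by (rule x_min)
    then show ?thesis using False by (simp add: r_def field_simps)
  qed
  have "sdp_optimal A0 A1 (outer x)"
    unfolding sdp_optimal_def
  proof (intro conjI allI impI)
    show "sdp_feasible A1 (outer x)"
      using x by (simp add: sdp_feasible_def sdp_linear_constraints_def hgtrs_feasible_def
          mat_inner_outer pos_semidef_outer)
    fix X assume X: "sdp_feasible A1 X"
    then have "pos_semidef X" and "mat_inner A1 X \<le> 0"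
      by (auto simp: sdp_feasible_def sdp_linear_constraints_def)
    then obtain z :: "'m option \<Rightarrow> real^'m option"
      where z: "X = (\<Sum>i\<in>UNIV. outer (z i))" "\<And>i. z i \<bullet> (A1 *v z i) \<le> 0"
      using Sturm_Zhang_decomposition by metis
    \<comment> \<open>The constraint on \<open>E11\<close> turns the squared first coordinates into
      weights of total one.\<close>
    have "(\<Sum>i\<in>UNIV. (z i $ None)\<^sup>2) = 1"
      using X by (simp add: sdp_feasible_def sdp_linear_constraints_def z(1)
          mat_inner_sum_right mat_inner_outer E11_form)
    then have "v = (\<Sum>i\<in>UNIV. v * (z i $ None)\<^sup>2)"
      by (simp flip: sum_distrib_left)
    also have "\<dots> \<le> (\<Sum>i\<in>UNIV. z i \<bullet> (A0 *v z i))"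
      by (intro sum_mono cone_bound z(2))
    also have "\<dots> = mat_inner A0 X"
      by (simp add: z(1) mat_inner_sum_right mat_inner_outer)
    finally show "mat_inner A0 (outer x) \<le> mat_inner A0 X"
      by (simp add: mat_inner_outer v_def)
  qed
  then show ?thesis by (auto simp: sdp_exact_def)
qed

theorem theorem4p3:
  fixes Q0 Q1 :: "real^'m^'m" and q0 q1 :: "real^'m" and b0 b1 :: real
    and A0 A1 :: "real^'m option^'m option"
  assumes "symmetric_matrix Q0" and "symmetric_matrix Q1"
    and "b0 = 0"
    and "A0 = homogenized b0 q0 Q0" and "A1 = homogenized b1 q1 Q1"
    and feasible: "\<exists>x. hgtrs_feasible A1 x"
    and dual_interior: "\<exists>y1 y2 y3 :: real. y1 \<ge> 0 \<and> y2 \<ge> 0 \<and> y3 \<ge> 0 \<and>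
      pos_def (y1 *\<^sub>R A1 + y2 *\<^sub>R E11 - y3 *\<^sub>R E11)"
    and primal_interior: "\<exists>X. sdp_interior_feasible A1 X"
  shows "sdp_exact A0 A1"
proof -
  obtain x0 where x0: "hgtrs_feasible A1 x0" using feasible by blast
  obtain y1 y2 y3 :: real where "y1 \<ge> 0" and pd: "pos_def (y1 *\<^sub>R A1 + y2 *\<^sub>R E11 - y3 *\<^sub>R E11)"
    using dual_interior by blast
  \<comment> \<open>The multipliers of the two inequalities that encode the equality merge into one
    multiplier of free sign.\<close>
  have "y1 *\<^sub>R A1 + (y2 - y3) *\<^sub>R E11 = y1 *\<^sub>R A1 + y2 *\<^sub>R E11 - y3 *\<^sub>R E11"
    by (simp add: scaleR_diff_left)
  then show ?thesis using sdp_exact_of_coercive[OF x0 \<open>y1 \<ge> 0\<close>] pd by metis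
qed

end
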